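(* Consider, with periodic boundaries, the scheme $$\mathbf{B}_c^{n+1}=\mathbf{B}_c^n-\Delta t\,c_0\nabla_c^p\times\mathbf{E}_p^{n+\frac12}-\Delta t\,c_h\nabla_c^p\phi_p^{n+\frac12},\qquad \phi_p^{n+1}=\phi_p^n-\Delta t\,c_h\nabla_p^c\cdot\mathbf{B}_c^{n+\frac12},$$ $$\mathbf{E}_p^{n+1}=\mathbf{E}_p^n+\Delta t\,c_0\nabla_p^c\times\mathbf{B}_c^{n+\frac12}-\Delta t\,c_h\nabla_p^c\psi_c^{n+\frac12},\qquad \psi_c^{n+1}=\psi_c^n-\Delta t\,c_h\nabla_c^p\cdot\mathbf{E}_p^{n+\frac12},$$ where $X^{n+\frac12}=\frac12(X^n+X^{n+1})$ for each of the fields $X$, with well-prepared initial data $\phi_p^0=\phi^0=\text{const}$ (the same for all $p$) and $\psi_c^0=\psi^0=\text{const}$ (the same for all $c$). Then the scheme is asymptotic-preserving in the sense that, for a fixed mesh, fixed $\Delta t>0$, fixed $c_0>0$ and fixed initial data (independent of $c_h$), for every fixed $n\ge0$, $p$ and $c$, $$\nabla_c^p\cdot\mathbf{E}_p^{n+\frac12}=\mathcal{O}(\epsilon^2),\qquad \nabla_p^c\cdot\mathbf{B}_c^{n+\frac12}=\mathcal{O}(\epsilon^2)\qquad\text{as } c_h\to\infty,\ \text{i.e. as }\epsilon=c_0/c_h\to0.$$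
   Context: Staggered mesh with periodic boundaries: there are finitely many primary control volumes $\Omega_c$ (area $|\Omega_c|>0$, centers $\mathbf{x}_c$) and dual control volumes $\Omega_p$ (area $|\Omega_p|>0$) centered at the vertices $\mathbf{x}_p$ of the primary mesh, with $\sum_c|\Omega_c|=\sum_p|\Omega_p|$. Write $p\in\Omega_c$ if $\mathbf{x}_p$ is a vertex of $\Omega_c$, and $c\in\Omega_p$ if $\mathbf{x}_c$ is a vertex of $\Omega_p$; $p\in\Omega_c$ iff $c\in\Omega_p$. To each such pair belongs a corner vector $l_{pc}\mathbf{n}_{pc}\in\mathbb{R}^3$, $\mathbf{n}_{cp}=-\mathbf{n}_{pc}$, with $\sum_{p\in\Omega_c}l_{pc}\mathbf{n}_{pc}=0$ for every $c$ and $\sum_{c\in\Omega_p}l_{pc}\mathbf{n}_{cp}=0$ for every $p$. On a uniform two-dimensional Cartesian mesh with spacings $\Delta x,\Delta y$, for $c=(i,j)$ and $p=(i+\frac{s}{2},j+\frac{s'}{2})$ with $s,s'\in\{\pm1\}$, one has $|\Omega_c|=|\Omega_p|=\Delta x\Delta y$ and $l_{pc}\mathbf{n}_{pc}=\frac12(s\Delta y,\,s'\Delta x,\,0)$. $\mathbf{B}_c^n\in\mathbb{R}^3$, $\psi_c^n\in\mathbb{R}$ live at the primary cells, $\mathbf{E}_p^n\in\mathbb{R}^3$, $\phi_p^n\in\mathbb{R}$ at the vertices. Discrete operators, where $\ast$ stands for multiplication by a scalar field (gradient), dot product (divergence) or cross product (curl): $\nabla_c^p\ast u_p=\frac1{|\Omega_c|}\sum_{p\in\Omega_c}l_{pc}\mathbf{n}_{pc}\ast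 u_p$ and $\nabla_p^c\ast u_c=\frac1{|\Omega_p|}\sum_{c\in\Omega_p}l_{pc}\mathbf{n}_{cp}\ast u_c$. These satisfy the discrete identities $\nabla_c^p\times\nabla_p^c\phi_c=0$, $\nabla_p^c\times\nabla_c^p\phi_p=0$, $\nabla_c^p\cdot\nabla_p^c\times\mathbf{A}_c=0$, $\nabla_p^c\cdot\nabla_c^p\times\mathbf{A}_p=0$. *)

theory Defs
  imports "HOL-Analysis.Analysis" "HOL-Library.Landau_Symbols"
begin

text \<open>
  A staggered mesh with periodic boundaries has finitely many primary cells (type \<open>'c\<close>)
  and finitely many vertices, i.e. dual cells (type \<open>'p\<close>). The cell geometry enters the
  scheme only through the data below. The relation \<open>incident M p c\<close> renders both
  ``\<open>p\<close> is a vertex of cell \<open>c\<close>'' and ``\<open>c\<close> is a vertex of dual cell \<open>p\<close>'', which are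
  equivalent. Lengths and normals matter only for incident pairs.
\<close>

record ('c, 'p) mesh =
  cell_area :: "'c \<Rightarrow> real"
  dual_area :: "'p \<Rightarrow> real"
  incident :: "'p \<Rightarrow> 'c \<Rightarrow> bool"
  corner_len :: "'p \<Rightarrow> 'c \<Rightarrow> real"
  normal_pc :: "'p \<Rightarrow> 'c \<Rightarrow> real^3"

definition verts_of_cell :: "('c, 'p) mesh \<Rightarrow> 'c \<Rightarrow> 'p set" where
  "verts_of_cell M c = {p. incident M p c}"

definition cells_of_vert :: "('c, 'p) mesh \<Rightarrow> 'p \<Rightarrow> 'c set" where
  "cells_of_vert M p = {c. incident M p c}"

definition normal_cp :: "('c, 'p) mesh \<Rightarrow> 'c \<Rightarrow> 'p \<Rightarrow> real^3" where
  "normal_cp M c p = - normal_pc M p c"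

text \<open>
  Generic operators: \<open>nabla_c\<close> maps vertex fields to cell fields and \<open>nabla_p\<close> maps cell
  fields to vertex fields. The argument \<open>star\<close> is the product of a corner vector with a
  field value.
\<close>

definition nabla_c ::
  "('c, 'p) mesh \<Rightarrow> (real^3 \<Rightarrow> 'u \<Rightarrow> 'r::real_vector) \<Rightarrow> ('p \<Rightarrow> 'u) \<Rightarrow> 'c \<Rightarrow> 'r" where
  "nabla_c M star u c =
     (1 / cell_area M c) *\<^sub>R
       (\<Sum>p\<in>verts_of_cell M c. star (corner_len M p c *\<^sub>R normal_pc M p c) (u p))"

definition nabla_p ::
  "('c, 'p) mesh \<Rightarrow> (real^3 \<Rightarrow> 'u \<Rightarrow> 'r::real_vector) \<Rightarrow> ('c \<Rightarrow> 'u) \<Rightarrow> 'p \<Rightarrow> 'r" where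
  "nabla_p M star u p =
     (1 / dual_area M p) *\<^sub>R
       (\<Sum>c\<in>cells_of_vert M p. star (corner_len M p c *\<^sub>R normal_cp M c p) (u c))"

definition grad_c :: "('c, 'p) mesh \<Rightarrow> ('p \<Rightarrow> real) \<Rightarrow> 'c \<Rightarrow> real^3" where
  "grad_c M = nabla_c M (\<lambda>v s. s *\<^sub>R v)"

definition div_c :: "('c, 'p) mesh \<Rightarrow> ('p \<Rightarrow> real^3) \<Rightarrow> 'c \<Rightarrow> real" where
  "div_c M = nabla_c M (\<lambda>v w. v \<bullet> w)"

definition curl_c :: "('c, 'p) mesh \<Rightarrow> ('p \<Rightarrow> real^3) \<Rightarrow> 'c \<Rightarrow> real^3" where
  "curl_c M = nabla_c M cross3"

definition grad_p :: "('c, 'p) mesh \<Rightarrow> ('c \<Rightarrow> real) \<Rightarrow> 'p \<Rightarrow> real^3" where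
  "grad_p M = nabla_p M (\<lambda>v s. s *\<^sub>R v)"

definition div_p :: "('c, 'p) mesh \<Rightarrow> ('c \<Rightarrow> real^3) \<Rightarrow> 'p \<Rightarrow> real" where
  "div_p M = nabla_p M (\<lambda>v w. v \<bullet> w)"

definition curl_p :: "('c, 'p) mesh \<Rightarrow> ('c \<Rightarrow> real^3) \<Rightarrow> 'p \<Rightarrow> real^3" where
  "curl_p M = nabla_p M cross3"

text \<open>
  The last four clauses are the discrete identities (curl grad = 0 and div curl = 0, on
  cells and on vertices). They are part of the standing assumptions on the mesh, as they
  do not follow from the preceding clauses alone.
\<close>

definition staggered_mesh :: "('c::finite, 'p::finite) mesh \<Rightarrow> bool" where
  "staggered_mesh M \<longleftrightarrow>
     (\<forall>c. cell_area M c > 0) \<and>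
     (\<forall>p. dual_area M p > 0) \<and>
     (\<Sum>c\<in>UNIV. cell_area M c) = (\<Sum>p\<in>UNIV. dual_area M p) \<and>
     (\<forall>c. (\<Sum>p\<in>verts_of_cell M c. corner_len M p c *\<^sub>R normal_pc M p c) = 0) \<and>
     (\<forall>p. (\<Sum>c\<in>cells_of_vert M p. corner_len M p c *\<^sub>R normal_cp M c p) = 0) \<and>
     (\<forall>f c. curl_c M (grad_p M f) c = 0) \<and>
     (\<forall>f p. curl_p M (grad_c M f) p = 0) \<and>
     (\<forall>A c. div_c M (curl_p M A) c = 0) \<and>
     (\<forall>A p. div_p M (curl_c M A) p = 0)"

definition mid :: "(nat \<Rightarrow> 'a \<Rightarrow> 'v::real_vector) \<Rightarrow> nat \<Rightarrow> 'a \<Rightarrow> 'v" where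
  "mid X n x = (1/2) *\<^sub>R (X n x + X (Suc n) x)"

definition scheme ::
  "('c, 'p) mesh \<Rightarrow> real \<Rightarrow> real \<Rightarrow> real \<Rightarrow>
   (nat \<Rightarrow> 'c \<Rightarrow> real^3) \<Rightarrow> (nat \<Rightarrow> 'p \<Rightarrow> real) \<Rightarrow>
   (nat \<Rightarrow> 'p \<Rightarrow> real^3) \<Rightarrow> (nat \<Rightarrow> 'c \<Rightarrow> real) \<Rightarrow> bool" where
  "scheme M \<Delta>t c\<^sub>0 c\<^sub>h B \<phi> E \<psi> \<longleftrightarrow>
     (\<forall>n.
       (\<forall>c. B (Suc n) c = B n c - (\<Delta>t * c\<^sub>0) *\<^sub>R curl_c M (mid E n) c
                                  - (\<Delta>t * c\<^sub>h) *\<^sub>R grad_c M (mid \<phi> n) c) \<and>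
       (\<forall>p. \<phi> (Suc n) p = \<phi> n p - \<Delta>t * c\<^sub>h * div_p M (mid B n) p) \<and>
       (\<forall>p. E (Suc n) p = E n p + (\<Delta>t * c\<^sub>0) *\<^sub>R curl_p M (mid B n) p
                                  - (\<Delta>t * c\<^sub>h) *\<^sub>R grad_p M (mid \<psi> n) p) \<and>
       (\<forall>c. \<psi> (Suc n) c = \<psi> n c - \<Delta>t * c\<^sub>h * div_c M (mid E n) c))"

end

theory Submission
  imports Defs
begin

text \<open>
  Write \<open>a = \<Delta>t * c\<^sub>h\<close>. Since \<open>div curl = 0\<close>, taking the divergence of the
  evolution equation for \<open>E\<close> removes \<open>B\<close> from it: with \<open>d\<^sub>n = div E\<^sup>n\<close>,
  \<open>L = div grad\<close> and a bar for the average of two consecutive time levels,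
  \<open>d\<^bsub>n+1\<^esub> = d\<^sub>n - a L \<psi>bar\<close> and \<open>\<psi>\<^bsub>n+1\<^esub> = \<psi>\<^sub>n - a dbar\<close>.

  Discrete divergence and gradient are adjoint up to sign for the area-weighted inner products
  (\<open>cell_ip_div_c\<close>), so this implicit midpoint rule conserves
  \<open>\<parallel>d\<^sub>n\<parallel>\<^sup>2 + \<parallel>grad \<psi>\<^sub>n\<parallel>\<^sup>2\<close> (\<open>cleaning_energy_conserved\<close>). At time zero the second term
  vanishes because \<open>\<psi>\<^sup>0\<close> is constant, so \<open>d\<^sub>n\<close> is bounded uniformly in \<open>n\<close> and in \<open>c\<^sub>h\<close>.

  One factor \<open>1/a\<close> comes from the first equation: \<open>L \<psi>bar = (d\<^sub>n - d\<^bsub>n+1\<^esub>) / a\<close> is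
  \<open>O(1/a)\<close>. The second equation keeps \<open>\<psi>\<^sub>n - \<psi>\<^sup>0\<close> in the range of the divergence, on which
  \<open>L\<close> is injective, hence bounded below in finite dimension (\<open>laplacian_coercive\<close>); so the
  average of \<open>\<psi> - \<psi>\<^sup>0\<close> over each step is \<open>O(1/a)\<close>. As \<open>\<psi> - \<psi>\<^sup>0\<close> starts from zero,
  it is then \<open>O(1/a)\<close> at each fixed time level. The second factor \<open>1/a\<close>
  comes from the second equation: \<open>dbar = (\<psi>\<^sub>n - \<psi>\<^bsub>n+1\<^esub>) / a\<close>.

  Exchanging primary and dual cells turns the pair \<open>(B, \<phi>)\<close> into a pair of the same kind,
  so the same estimate covers the divergence of \<open>B\<close>.
\<close>

section \<open>Linearity and adjointness of divergence and gradient\<close>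

lemma div_c_lincomb:
  "div_c M (\<lambda>p. r *\<^sub>R e p + s *\<^sub>R f p) c = r * div_c M e c + s * div_c M f c"
  unfolding div_c_def nabla_c_def
  by (simp add: inner_add_right sum.distrib sum_distrib_left algebra_simps)

lemma grad_p_lincomb:
  "grad_p M (\<lambda>c. r * u c + s * v c) p = r *\<^sub>R grad_p M u p + s *\<^sub>R grad_p M v p"
  unfolding grad_p_def nabla_p_def
  by (simp add: sum.distrib scaleR_sum_right algebra_simps)

lemma grad_p_const:
  assumes "(\<Sum>c\<in>cells_of_vert M p. corner_len M p c *\<^sub>R normal_cp M c p) = 0"
  shows "grad_p M (\<lambda>c. k) p = 0"
  unfolding grad_p_def nabla_p_def by (simp only: scaleR_sum_right[symmetric] assms scaleR_zero_right)

lemma div_c_mid: "div_c M (mid F n) c = (div_c M (F n) c + div_c M (F (Suc n)) c) / 2"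
proof -
  have "mid F n = (\<lambda>p. (1/2) *\<^sub>R F n p + (1/2) *\<^sub>R F (Suc n) p)"
    by (simp add: mid_def fun_eq_iff scaleR_add_right)
  then show ?thesis by (simp add: div_c_lincomb)
qed

definition cell_ip :: "('c::finite, 'p) mesh \<Rightarrow> ('c \<Rightarrow> real) \<Rightarrow> ('c \<Rightarrow> real) \<Rightarrow> real" where
  "cell_ip M u v = (\<Sum>c\<in>UNIV. cell_area M c * (u c * v c))"

definition vert_ip ::
  "('c, 'p::finite) mesh \<Rightarrow> ('p \<Rightarrow> real^3) \<Rightarrow> ('p \<Rightarrow> real^3) \<Rightarrow> real" where
  "vert_ip M e f = (\<Sum>p\<in>UNIV. dual_area M p * (e p \<bullet> f p))"

lemma cell_ip_diff_squares:
  "cell_ip M u u - cell_ip M v v = cell_ip M (\<lambda>c. u c - v c) (\<lambda>c. u c + v c)"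
  by (simp add: cell_ip_def algebra_simps flip: sum_subtractf)

lemma vert_ip_diff_squares:
  "vert_ip M e e - vert_ip M f f = vert_ip M (\<lambda>p. e p - f p) (\<lambda>p. e p + f p)"
  by (simp add: vert_ip_def algebra_simps inner_commute flip: sum_subtractf)

lemma cell_ip_scale: "cell_ip M (\<lambda>c. r * u c) (\<lambda>c. s * v c) = r * s * cell_ip M u v"
  by (simp add: cell_ip_def sum_distrib_left algebra_simps)

lemma vert_ip_scale: "vert_ip M (\<lambda>p. r *\<^sub>R e p) (\<lambda>p. s *\<^sub>R f p) = r * s * vert_ip M e f"
  by (simp add: vert_ip_def sum_distrib_left algebra_simps)

lemma cell_ip_commute: "cell_ip M u v = cell_ip M v u"
  by (simp add: cell_ip_def mult.commute)

lemma vert_ip_zero [simp]: "vert_ip M (\<lambda>p. 0) f = 0"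
  by (simp add: vert_ip_def)

lemma vert_ip_self_nonneg:
  assumes "\<And>p. dual_area M p > 0"
  shows "vert_ip M e e \<ge> 0"
  unfolding vert_ip_def using assms by (intro sum_nonneg) (simp add: less_imp_le)

lemma vert_ip_self_eq_0:
  assumes "\<And>p. dual_area M p > 0" and "vert_ip M e e = 0"
  shows "e p = 0"
proof -
  have "\<forall>p\<in>UNIV. dual_area M p * (e p \<bullet> e p) = 0"
    using assms(2) unfolding vert_ip_def
    by (subst (asm) sum_nonneg_eq_0_iff) (use assms(1) in \<open>auto simp: less_imp_le\<close>)
  then show ?thesis using assms(1)[of p] by (auto dest: spec[of _ p])
qed

lemma cell_area_square_le_cell_ip:
  assumes "\<And>c. cell_area M c > 0"
  shows "cell_area M c * (u c)\<^sup>2 \<le> cell_ip M u u"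
  unfolding cell_ip_def power2_eq_square
  by (rule member_le_sum) (use assms in \<open>auto simp: less_imp_le\<close>)

text \<open>
  Summation by parts: both sides are the sum of \<open>u c * (l n \<bullet> e p)\<close> over all incident pairs,
  one grouped by cells and one by vertices; the areas cancel the normalisations of the
  operators, and the sign is that of \<open>normal_cp\<close> against \<open>normal_pc\<close>.
\<close>

lemma cell_ip_div_c:
  assumes "\<And>c. cell_area M c > 0" and "\<And>p. dual_area M p > 0"
  shows "cell_ip M u (div_c M e) = - vert_ip M (grad_p M u) e"
proof -
  let ?t = "\<lambda>p c. if incident M p c then u c * ((corner_len M p c *\<^sub>R normal_pc M p c) \<bullet> e p) else 0"
  have "cell_ip M u (div_c M e) = (\<Sum>c\<in>UNIV. \<Sum>p\<in>UNIV. ?t p c)"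
    unfolding cell_ip_def
  proof (rule sum.cong[OF refl])
    fix c
    have "cell_area M c * (u c * div_c M e c)
        = u c * (\<Sum>p\<in>verts_of_cell M c. (corner_len M p c *\<^sub>R normal_pc M p c) \<bullet> e p)"
      using assms(1)[of c] by (simp add: div_c_def nabla_c_def)
    then show "cell_area M c * (u c * div_c M e c) = (\<Sum>p\<in>UNIV. ?t p c)"
      by (simp add: verts_of_cell_def sum_distrib_left sum.If_cases)
  qed
  also have "\<dots> = (\<Sum>p\<in>UNIV. \<Sum>c\<in>UNIV. ?t p c)"
    by (rule sum.swap)
  also have "\<dots> = (\<Sum>p\<in>UNIV. - (dual_area M p * (grad_p M u p \<bullet> e p)))"
  proof (rule sum.cong[OF refl])
    fix p
    have "dual_area M p * (grad_p M u p \<bullet> e p)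
        = (\<Sum>c\<in>cells_of_vert M p. u c *\<^sub>R corner_len M p c *\<^sub>R normal_cp M c p) \<bullet> e p"
      using assms(2)[of p] by (simp add: grad_p_def nabla_p_def)
    then show "(\<Sum>c\<in>UNIV. ?t p c) = - (dual_area M p * (grad_p M u p \<bullet> e p))"
      by (simp add: cells_of_vert_def normal_cp_def inner_sum_left sum.If_cases sum_negf mult.assoc)
  qed
  finally show ?thesis
    by (simp add: vert_ip_def sum_negf)
qed

section \<open>Coercivity of the discrete Laplacian on the range of the divergence\<close>

text \<open>
  If \<open>u = div e\<close> and \<open>L u = 0\<close>, then pairing \<open>L u\<close> with \<open>u\<close> gives \<open>grad u = 0\<close>, and
  pairing \<open>u\<close> with \<open>div e\<close> then gives \<open>u = 0\<close>.
\<close>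

lemma laplacian_injective_on_range_div:
  fixes M :: "('c::finite, 'p::finite) mesh"
  assumes cpos: "\<And>c. cell_area M c > 0" and dpos: "\<And>p. dual_area M p > 0"
    and zero: "\<And>c. div_c M (grad_p M (div_c M e)) c = 0"
  shows "div_c M e c = 0"
proof -
  let ?u = "div_c M e"
  have "cell_ip M ?u (div_c M (grad_p M ?u)) = 0"
    by (simp add: cell_ip_def zero)
  then have "vert_ip M (grad_p M ?u) (grad_p M ?u) = 0"
    by (simp add: cell_ip_div_c[OF cpos dpos])
  then have "grad_p M ?u = (\<lambda>p. 0)"
    using vert_ip_self_eq_0[OF dpos] by blast
  then have "cell_ip M ?u ?u = 0"
    by (simp add: cell_ip_div_c[OF cpos dpos])
  then have "cell_area M c * (?u c)\<^sup>2 \<le> 0"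
    using cell_area_square_le_cell_ip[OF cpos, of c ?u] by simp
  then show ?thesis
    using cpos[of c] by (simp add: mult_le_0_iff)
qed

text \<open>
  An injective linear map on a finite-dimensional space is bounded below. The cell fields are
  moved to \<open>real^'c\<close>, which carries the Euclidean structure that this needs.
\<close>

lemma laplacian_coercive:
  fixes M :: "('c::finite, 'p::finite) mesh"
  assumes cpos: "\<And>c. cell_area M c > 0" and dpos: "\<And>p. dual_area M p > 0"
  obtains K where "K \<ge> 0"
    and "\<And>e c. \<bar>div_c M e c\<bar> \<le> K * (\<Sum>c'\<in>UNIV. \<bar>div_c M (grad_p M (div_c M e)) c'\<bar>)"
proof -
  define S :: "(real^'c) set" where "S = range (\<lambda>e. \<chi> c. div_c M e c)"
  define f :: "real^'c \<Rightarrow> real^'c" where "f x = (\<chi> c. div_c M (grad_p M (($) x)) c)" for x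
  have lincomb_S: "r *\<^sub>R x + s *\<^sub>R y \<in> S" if "x \<in> S" "y \<in> S" for x y r s
  proof -
    from that obtain e g where "x = (\<chi> c. div_c M e c)" "y = (\<chi> c. div_c M g c)"
      unfolding S_def by blast
    then have "r *\<^sub>R x + s *\<^sub>R y = (\<chi> c. div_c M (\<lambda>p. r *\<^sub>R e p + s *\<^sub>R g p) c)"
      by (simp add: vec_eq_iff div_c_lincomb)
    then show ?thesis unfolding S_def by blast
  qed
  have sub: "subspace S"
  proof (rule subspaceI)
    have "(\<chi> c. div_c M (\<lambda>p. 0) c) \<in> S" unfolding S_def by blast
    from lincomb_S[OF this this, of 0 0] show "0 \<in> S" by simp
    show "x + y \<in> S" if "x \<in> S" "y \<in> S" for x y
      using lincomb_S[OF that, of 1 1] by simp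
    show "r *\<^sub>R x \<in> S" if "x \<in> S" for r x
      using lincomb_S[OF that that, of r 0] by simp
  qed
  have f_lincomb: "f (r *\<^sub>R x + s *\<^sub>R y) = r *\<^sub>R f x + s *\<^sub>R f y" for r s x y
  proof -
    have "($) (r *\<^sub>R x + s *\<^sub>R y) = (\<lambda>c. r * x $ c + s * y $ c)"
      by (simp add: fun_eq_iff)
    moreover have "grad_p M (\<lambda>c. r * x $ c + s * y $ c)
        = (\<lambda>p. r *\<^sub>R grad_p M (($) x) p + s *\<^sub>R grad_p M (($) y) p)"
      by (rule ext) (rule grad_p_lincomb)
    ultimately show ?thesis
      by (simp add: f_def vec_eq_iff div_c_lincomb)
  qed
  have "linear f"
  proof (rule linearI)
    show "f (x + y) = f x + f y" for x y using f_lincomb[of 1 x 1 y] by simp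
    show "f (r *\<^sub>R x) = r *\<^sub>R f x" for r x using f_lincomb[of r x 0 x] by simp
  qed
  then have bl: "bounded_linear f" by (rule linear_conv_bounded_linear[THEN iffD1])
  have inj: "\<forall>x\<in>S. f x = 0 \<longrightarrow> x = 0"
  proof (intro ballI impI)
    fix x assume "x \<in> S" and fx: "f x = 0"
    then obtain e where x: "x = (\<chi> c. div_c M e c)" unfolding S_def by blast
    have "($) x = div_c M e" by (simp add: x fun_eq_iff)
    then have "div_c M (grad_p M (div_c M e)) c = 0" for c
      using fx by (simp add: f_def vec_eq_iff)
    then show "x = 0"
      using laplacian_injective_on_range_div[OF cpos dpos] by (simp add: x vec_eq_iff)
  qed
  obtain k where k: "k > 0" "\<forall>x\<in>S. k * norm x \<le> norm (f x)"
    using injective_imp_isometric[OF closed_subspace[OF sub] sub bl inj]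
    by (auto simp: mult.commute)
  show ?thesis
  proof (rule that[of "1 / k"])
    fix e c
    let ?x = "\<chi> c. div_c M e c"
    have ex: "($) ?x = div_c M e" by (simp add: fun_eq_iff)
    have "k * \<bar>div_c M e c\<bar> \<le> k * norm ?x"
      using component_le_norm_cart[of ?x c] k(1) by simp
    also have "\<dots> \<le> norm (f ?x)"
      using k(2) unfolding S_def by blast
    also have "\<dots> \<le> (\<Sum>c'\<in>UNIV. \<bar>f ?x $ c'\<bar>)"
      by (rule norm_le_l1_cart)
    also have "\<dots> = (\<Sum>c'\<in>UNIV. \<bar>div_c M (grad_p M (div_c M e)) c'\<bar>)"
      unfolding f_def ex by simp
    finally show "\<bar>div_c M e c\<bar> \<le> 1 / k * (\<Sum>c'\<in>UNIV. \<bar>div_c M (grad_p M (div_c M e)) c'\<bar>)"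
      using k(1) by (simp add: field_simps)
  qed (use k(1) in simp)
qed

section \<open>The divergence cleaning system\<close>

text \<open>
  The subsystem that remains once the curl terms have been removed by taking the divergence;
  \<open>a\<close> stands for \<open>\<Delta>t * c\<^sub>h\<close>.
\<close>

definition cleaning_system ::
  "('c, 'p) mesh \<Rightarrow> real \<Rightarrow> (nat \<Rightarrow> 'p \<Rightarrow> real^3) \<Rightarrow> (nat \<Rightarrow> 'c \<Rightarrow> real) \<Rightarrow> bool" where
  "cleaning_system M a F \<psi> \<longleftrightarrow>
     (\<forall>n c. div_c M (F (Suc n)) c = div_c M (F n) c - a * div_c M (grad_p M (mid \<psi> n)) c \<and>
            \<psi> (Suc n) c = \<psi> n c - a * div_c M (mid F n) c)"

text \<open>
  Over one step the first term changes by \<open>2a\<close> times the pairing of \<open>grad dbar\<close> with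
  \<open>grad \<psi>bar\<close> and the second by the negative of that: adjointness makes the coupling of
  \<open>d\<close> and \<open>\<psi>\<close> skew, and the midpoint rule conserves quadratic invariants.
\<close>

lemma cleaning_energy_conserved:
  fixes M :: "('c::finite, 'p::finite) mesh"
  assumes cpos: "\<And>c. cell_area M c > 0" and dpos: "\<And>p. dual_area M p > 0"
    and sys: "cleaning_system M a F \<psi>"
  shows "cell_ip M (div_c M (F n)) (div_c M (F n))
         + vert_ip M (grad_p M (\<psi> n)) (grad_p M (\<psi> n))
       = cell_ip M (div_c M (F 0)) (div_c M (F 0))
         + vert_ip M (grad_p M (\<psi> 0)) (grad_p M (\<psi> 0))"
proof (induction n)
  case 0
  show ?case by simp
next
  case (Suc n)
  let ?d = "div_c M (F n)" and ?d' = "div_c M (F (Suc n))"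
  let ?g = "grad_p M (\<psi> n)" and ?g' = "grad_p M (\<psi> (Suc n))"
  let ?x = "div_c M (mid F n)" and ?y = "mid \<psi> n"
  have d_diff: "(\<lambda>c. ?d' c - ?d c) = (\<lambda>c. (- a) * div_c M (grad_p M ?y) c)"
    using sys by (simp add: cleaning_system_def)
  have d_sum: "(\<lambda>c. ?d' c + ?d c) = (\<lambda>c. 2 * ?x c)"
    by (simp add: div_c_mid fun_eq_iff)
  have "\<psi> (Suc n) = (\<lambda>c. 1 * \<psi> n c + (- a) * ?x c)"
    using sys by (simp add: cleaning_system_def fun_eq_iff)
  then have "?g' p = 1 *\<^sub>R ?g p + (- a) *\<^sub>R grad_p M ?x p" for p
    by (simp only: grad_p_lincomb)
  then have g_diff: "(\<lambda>p. ?g' p - ?g p) = (\<lambda>p. (- a) *\<^sub>R grad_p M ?x p)"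
    by (simp add: fun_eq_iff)
  have "?y = (\<lambda>c. (1/2) * \<psi> n c + (1/2) * \<psi> (Suc n) c)"
    by (simp add: mid_def fun_eq_iff)
  then have "grad_p M ?y p = (1/2) *\<^sub>R ?g p + (1/2) *\<^sub>R ?g' p" for p
    by (simp only: grad_p_lincomb)
  then have g_sum: "(\<lambda>p. ?g' p + ?g p) = (\<lambda>p. 2 *\<^sub>R grad_p M ?y p)"
    by (simp add: fun_eq_iff scaleR_add_right)
  have "cell_ip M ?d' ?d' - cell_ip M ?d ?d
      = (- a) * 2 * cell_ip M (div_c M (grad_p M ?y)) ?x"
    unfolding cell_ip_diff_squares d_diff d_sum by (rule cell_ip_scale)
  also have "cell_ip M (div_c M (grad_p M ?y)) ?x = - vert_ip M (grad_p M ?x) (grad_p M ?y)"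
    by (subst cell_ip_commute) (rule cell_ip_div_c[OF cpos dpos])
  finally have "cell_ip M ?d' ?d' - cell_ip M ?d ?d
      = 2 * a * vert_ip M (grad_p M ?x) (grad_p M ?y)" by simp
  moreover have "vert_ip M ?g' ?g' - vert_ip M ?g ?g
      = (- a) * 2 * vert_ip M (grad_p M ?x) (grad_p M ?y)"
    unfolding vert_ip_diff_squares g_diff g_sum by (rule vert_ip_scale)
  ultimately show ?case using Suc.IH by simp
qed

text \<open>
  Every increment of \<open>\<psi>\<close> is a multiple of a divergence, so the deviation from the constant
  initial value stays in the subspace on which \<open>laplacian_coercive\<close> applies.
\<close>

lemma cleaning_deviation_in_range_div:
  assumes sys: "cleaning_system M a F \<psi>" and init: "\<And>c. \<psi> 0 c = k"
  shows "\<exists>e. \<forall>c. \<psi> n c - k = div_c M e c"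
proof (induction n)
  case 0
  have "div_c M (\<lambda>p. 0) c = 0" for c
    by (simp add: div_c_def nabla_c_def)
  then show ?case using init by (intro exI[of _ "\<lambda>p. 0"]) simp
next
  case (Suc n)
  then obtain e where "\<And>c. \<psi> n c - k = div_c M e c" by blast
  then have "\<psi> (Suc n) c - k = div_c M (\<lambda>p. 1 *\<^sub>R e p + (- a) *\<^sub>R mid F n p) c" for c
    using sys unfolding div_c_lincomb by (simp add: cleaning_system_def algebra_simps)
  then show ?case by blast
qed

text \<open>
  The energy bounds \<open>d\<^sub>n\<close> by \<open>R\<close>, coercivity bounds the averages of \<open>\<psi> - k\<close> by \<open>Q / a\<close>, and
  each step adds at most \<open>2 Q / a\<close> to the deviation of \<open>\<psi>\<close> from \<open>k\<close>. The quantifier order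
  matters: \<open>Q\<close> depends on the mesh and on \<open>F0\<close> only, so fixed initial data give an estimate
  uniform in \<open>a\<close>.
\<close>

lemma cleaning_divergence_bound:
  fixes M :: "('c::finite, 'p::finite) mesh" and F0 :: "'p \<Rightarrow> real^3"
  assumes cpos: "\<And>c. cell_area M c > 0" and dpos: "\<And>p. dual_area M p > 0"
    and closed: "\<And>p. (\<Sum>c\<in>cells_of_vert M p. corner_len M p c *\<^sub>R normal_cp M c p) = 0"
  obtains Q where
    "\<And>a F \<psi> k n c. a > 0 \<Longrightarrow> cleaning_system M a F \<psi> \<Longrightarrow> F 0 = F0 \<Longrightarrow> (\<And>c. \<psi> 0 c = k) \<Longrightarrow>
       \<bar>div_c M (mid F n) c\<bar> \<le> real (4 * n + 2) * Q / a\<^sup>2"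
proof -
  obtain K where K: "K \<ge> 0"
    "\<And>e c. \<bar>div_c M e c\<bar> \<le> K * (\<Sum>c'\<in>UNIV. \<bar>div_c M (grad_p M (div_c M e)) c'\<bar>)"
    using laplacian_coercive[OF cpos dpos] by blast
  define R where "R c = sqrt (cell_ip M (div_c M F0) (div_c M F0) / cell_area M c)" for c
  define Q where "Q = K * (\<Sum>c\<in>UNIV. 2 * R c)"
  show ?thesis
  proof (rule that[of Q])
    fix a F \<psi> k n and c :: 'c
    assume a: "a > 0" and sys: "cleaning_system M a F \<psi>" and F0: "F 0 = F0"
      and init: "\<And>c. \<psi> 0 c = k"
    have d_bound: "\<bar>div_c M (F n) c\<bar> \<le> R c" for n c
    proof -
      have "\<psi> 0 = (\<lambda>c. k)" using init by blast
      then have "grad_p M (\<psi> 0) = (\<lambda>p. 0)"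
        by (intro ext) (simp only: grad_p_const[OF closed])
      then have "cell_ip M (div_c M (F n)) (div_c M (F n)) \<le> cell_ip M (div_c M F0) (div_c M F0)"
        using cleaning_energy_conserved[OF cpos dpos sys, of n]
          vert_ip_self_nonneg[OF dpos, of "grad_p M (\<psi> n)"] by (simp add: F0)
      then have "cell_area M c * (div_c M (F n) c)\<^sup>2 \<le> cell_ip M (div_c M F0) (div_c M F0)"
        using cell_area_square_le_cell_ip[OF cpos, of c "div_c M (F n)"] by linarith
      then have "(div_c M (F n) c)\<^sup>2 \<le> cell_ip M (div_c M F0) (div_c M F0) / cell_area M c"
        using cpos[of c] by (simp add: field_simps)
      then show ?thesis
        unfolding R_def using real_sqrt_le_mono by fastforce
    qed
    have mid_bound: "\<bar>mid \<psi> n c - k\<bar> \<le> Q / a" for n c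
    proof -
      obtain e e' where e: "\<And>c. \<psi> n c - k = div_c M e c" "\<And>c. \<psi> (Suc n) c - k = div_c M e' c"
        using cleaning_deviation_in_range_div[OF sys init] by meson
      define g where "g = (\<lambda>p. (1/2) *\<^sub>R e p + (1/2) *\<^sub>R e' p)"
      have g: "div_c M g = (\<lambda>c. 1 * mid \<psi> n c + (- 1) * k)"
        unfolding g_def div_c_lincomb e[symmetric] by (simp add: mid_def fun_eq_iff field_simps)
      \<comment> \<open>Constants lie in the kernel of the gradient, so subtracting \<open>k\<close> does not change
        the Laplacian.\<close>
      have "grad_p M (div_c M g) = grad_p M (mid \<psi> n)"
        unfolding g by (rule ext) (simp only: grad_p_lincomb grad_p_const[OF closed], simp)
      then have step: "a * div_c M (grad_p M (div_c M g)) c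
          = div_c M (F n) c - div_c M (F (Suc n)) c" for c
        using sys by (simp add: cleaning_system_def)
      have "\<bar>a * div_c M (grad_p M (div_c M g)) c\<bar> \<le> 2 * R c" for c
        using step[of c] d_bound[of n c] d_bound[of "Suc n" c] by linarith
      then have lap: "a * \<bar>div_c M (grad_p M (div_c M g)) c\<bar> \<le> 2 * R c" for c
        using a by (simp add: abs_mult)
      have "a * \<bar>div_c M g c\<bar> \<le> a * (K * (\<Sum>c'\<in>UNIV. \<bar>div_c M (grad_p M (div_c M g)) c'\<bar>))"
        using K(2)[of g c] a by simp
      also have "\<dots> = K * (\<Sum>c'\<in>UNIV. a * \<bar>div_c M (grad_p M (div_c M g)) c'\<bar>)"
        by (simp add: sum_distrib_left algebra_simps)
      also have "\<dots> \<le> Q"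
        unfolding Q_def by (intro mult_left_mono sum_mono lap K(1))
      finally show ?thesis
        using a by (simp add: g field_simps)
    qed
    have level_bound: "\<bar>\<psi> n c - k\<bar> \<le> real (2 * n) * (Q / a)" for n c
    proof (induction n)
      case 0
      show ?case by (simp add: init)
    next
      case (Suc n)
      have "\<psi> (Suc n) c - k = 2 * (mid \<psi> n c - k) - (\<psi> n c - k)"
        by (simp add: mid_def field_simps)
      then have "\<bar>\<psi> (Suc n) c - k\<bar> \<le> 2 * \<bar>mid \<psi> n c - k\<bar> + \<bar>\<psi> n c - k\<bar>"
        by (smt (verit))
      also have "\<dots> \<le> 2 * (Q / a) + real (2 * n) * (Q / a)"
        by (intro add_mono mult_left_mono mid_bound Suc.IH) simp
      finally show ?case by (simp add: algebra_simps)
    qed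
    have "a * div_c M (mid F n) c = \<psi> n c - \<psi> (Suc n) c"
      using sys by (simp add: cleaning_system_def)
    also have "\<dots> = 2 * (\<psi> n c - k) - 2 * (mid \<psi> n c - k)"
      by (simp add: mid_def field_simps)
    finally have "\<bar>a * div_c M (mid F n) c\<bar> \<le> 2 * \<bar>\<psi> n c - k\<bar> + 2 * \<bar>mid \<psi> n c - k\<bar>"
      by (smt (verit))
    also have "\<dots> \<le> 2 * (real (2 * n) * (Q / a)) + 2 * (Q / a)"
      by (intro add_mono mult_left_mono mid_bound level_bound) simp_all
    finally have "a * \<bar>div_c M (mid F n) c\<bar> \<le> real (4 * n + 2) * Q / a"
      using a by (simp add: abs_mult algebra_simps add_divide_distrib)
    then show "\<bar>div_c M (mid F n) c\<bar> \<le> real (4 * n + 2) * Q / a\<^sup>2"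
      using a by (simp add: field_simps power2_eq_square)
  qed
qed

lemma cleaning_divergence_bigo:
  fixes M :: "('c::finite, 'p::finite) mesh"
  assumes cpos: "\<And>c. cell_area M c > 0" and dpos: "\<And>p. dual_area M p > 0"
    and closed: "\<And>p. (\<Sum>c\<in>cells_of_vert M p. corner_len M p c *\<^sub>R normal_cp M c p) = 0"
    and "\<Delta>t > 0" and "c\<^sub>0 > 0"
    and sys: "\<And>c\<^sub>h. c\<^sub>h > 0 \<Longrightarrow> cleaning_system M (\<Delta>t * c\<^sub>h) (F c\<^sub>h) (\<psi> c\<^sub>h)"
    and init_F: "\<And>c\<^sub>h p. c\<^sub>h > 0 \<Longrightarrow> F c\<^sub>h 0 p = F0 p"
    and init_\<psi>: "\<And>c\<^sub>h c. c\<^sub>h > 0 \<Longrightarrow> \<psi> c\<^sub>h 0 c = k"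
  shows "(\<lambda>c\<^sub>h. div_c M (mid (F c\<^sub>h) n) c) \<in> O[at_top](\<lambda>c\<^sub>h. (c\<^sub>0 / c\<^sub>h)\<^sup>2)"
proof -
  obtain Q where Q: "\<And>a F \<psi> k n c. a > 0 \<Longrightarrow> cleaning_system M a F \<psi> \<Longrightarrow> F 0 = F0 \<Longrightarrow>
      (\<And>c. \<psi> 0 c = k) \<Longrightarrow> \<bar>div_c M (mid F n) c\<bar> \<le> real (4 * n + 2) * Q / a\<^sup>2"
    using cleaning_divergence_bound[OF cpos dpos closed] by blast
  have "norm (div_c M (mid (F c\<^sub>h) n) c)
      \<le> real (4 * n + 2) * Q / (\<Delta>t * c\<^sub>0)\<^sup>2 * norm ((c\<^sub>0 / c\<^sub>h)\<^sup>2)" if "c\<^sub>h > 0" for c\<^sub>h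
  proof -
    have "F c\<^sub>h 0 = F0" using init_F[OF that] by blast
    then have "\<bar>div_c M (mid (F c\<^sub>h) n) c\<bar> \<le> real (4 * n + 2) * Q / (\<Delta>t * c\<^sub>h)\<^sup>2"
      using Q[OF _ sys[OF that]] init_\<psi>[OF that] \<open>\<Delta>t > 0\<close> that by simp
    also have "\<dots> = real (4 * n + 2) * Q / (\<Delta>t * c\<^sub>0)\<^sup>2 * (c\<^sub>0 / c\<^sub>h)\<^sup>2"
      using \<open>c\<^sub>0 > 0\<close> by (simp add: power_mult_distrib power_divide)
    finally show ?thesis by simp
  qed
  then show ?thesis
    by (intro bigoI eventually_mono[OF eventually_gt_at_top[of 0]])
qed

section \<open>Exchanging primary and dual cells\<close>

definition dual_mesh :: "('c, 'p) mesh \<Rightarrow> ('p, 'c) mesh" where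
  "dual_mesh M = \<lparr>cell_area = dual_area M, dual_area = cell_area M,
     incident = (\<lambda>c p. incident M p c), corner_len = (\<lambda>c p. corner_len M p c),
     normal_pc = normal_cp M\<rparr>"

lemma dual_mesh_simps:
  "cell_area (dual_mesh M) = dual_area M"
  "dual_area (dual_mesh M) = cell_area M"
  "corner_len (dual_mesh M) c p = corner_len M p c"
  "normal_pc (dual_mesh M) = normal_cp M"
  "normal_cp (dual_mesh M) p c = normal_pc M p c"
  "verts_of_cell (dual_mesh M) = cells_of_vert M"
  "cells_of_vert (dual_mesh M) = verts_of_cell M"
  by (auto simp: dual_mesh_def normal_cp_def verts_of_cell_def cells_of_vert_def fun_eq_iff)

lemma div_c_dual_mesh: "div_c (dual_mesh M) = div_p M"
  by (simp add: div_c_def div_p_def nabla_c_def nabla_p_def dual_mesh_simps fun_eq_iff)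

lemma grad_p_dual_mesh: "grad_p (dual_mesh M) = grad_c M"
  by (simp add: grad_c_def grad_p_def nabla_c_def nabla_p_def dual_mesh_simps fun_eq_iff)

lemma div_c_divergence_free_update:
  assumes "\<And>p. F' p = F p + r *\<^sub>R X p - s *\<^sub>R G p" and "div_c M X c = 0"
  shows "div_c M F' c = div_c M F c - s * div_c M G c"
proof -
  have "F' = (\<lambda>p. 1 *\<^sub>R (1 *\<^sub>R F p + r *\<^sub>R X p) + (- s) *\<^sub>R G p)"
    using assms(1) by auto
  then show ?thesis using assms(2) by (simp only: div_c_lincomb) simp
qed

lemma scheme_cleaning_E:
  assumes "staggered_mesh M" and "scheme M \<Delta>t c\<^sub>0 c\<^sub>h B \<phi> E \<psi>"
  shows "cleaning_system M (\<Delta>t * c\<^sub>h) E \<psi>"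
  unfolding cleaning_system_def
proof (intro allI conjI)
  fix n c
  show "div_c M (E (Suc n)) c
      = div_c M (E n) c - \<Delta>t * c\<^sub>h * div_c M (grad_p M (mid \<psi> n)) c"
    by (rule div_c_divergence_free_update[where r = "\<Delta>t * c\<^sub>0" and X = "curl_p M (mid B n)"])
      (use assms in \<open>auto simp: scheme_def staggered_mesh_def\<close>)
  show "\<psi> (Suc n) c = \<psi> n c - \<Delta>t * c\<^sub>h * div_c M (mid E n) c"
    using assms(2) by (simp add: scheme_def)
qed

lemma scheme_cleaning_B:
  assumes "staggered_mesh M" and "scheme M \<Delta>t c\<^sub>0 c\<^sub>h B \<phi> E \<psi>"
  shows "cleaning_system (dual_mesh M) (\<Delta>t * c\<^sub>h) B \<phi>"
  unfolding cleaning_system_def grad_p_dual_mesh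
proof (intro allI conjI)
  fix n p
  show "div_c (dual_mesh M) (B (Suc n)) p
      = div_c (dual_mesh M) (B n) p - \<Delta>t * c\<^sub>h * div_c (dual_mesh M) (grad_c M (mid \<phi> n)) p"
    by (rule div_c_divergence_free_update[where r = "- (\<Delta>t * c\<^sub>0)" and X = "curl_c M (mid E n)"])
      (use assms in \<open>auto simp: scheme_def staggered_mesh_def div_c_dual_mesh\<close>)
  show "\<phi> (Suc n) p = \<phi> n p - \<Delta>t * c\<^sub>h * div_c (dual_mesh M) (mid B n) p"
    using assms(2) by (simp add: scheme_def div_c_dual_mesh)
qed

section \<open>The asymptotic-preserving property\<close>

theorem theorem4p3:
  fixes M :: "('c::finite, 'p::finite) mesh"
    and \<Delta>t c\<^sub>0 \<phi>0 \<psi>0 :: real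
    and B0 :: "'c \<Rightarrow> real^3" and E0 :: "'p \<Rightarrow> real^3"
    and B :: "real \<Rightarrow> nat \<Rightarrow> 'c \<Rightarrow> real^3" and \<phi> :: "real \<Rightarrow> nat \<Rightarrow> 'p \<Rightarrow> real"
    and E :: "real \<Rightarrow> nat \<Rightarrow> 'p \<Rightarrow> real^3" and \<psi> :: "real \<Rightarrow> nat \<Rightarrow> 'c \<Rightarrow> real"
  assumes mesh: "staggered_mesh M"
    and "\<Delta>t > 0" and "c\<^sub>0 > 0"
    and scheme: "\<And>c\<^sub>h. c\<^sub>h > 0 \<Longrightarrow> scheme M \<Delta>t c\<^sub>0 c\<^sub>h (B c\<^sub>h) (\<phi> c\<^sub>h) (E c\<^sub>h) (\<psi> c\<^sub>h)"
    and init_B: "\<And>c\<^sub>h c. c\<^sub>h > 0 \<Longrightarrow> B c\<^sub>h 0 c = B0 c"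
    and init_E: "\<And>c\<^sub>h p. c\<^sub>h > 0 \<Longrightarrow> E c\<^sub>h 0 p = E0 p"
    and init_\<phi>: "\<And>c\<^sub>h p. c\<^sub>h > 0 \<Longrightarrow> \<phi> c\<^sub>h 0 p = \<phi>0"
    and init_\<psi>: "\<And>c\<^sub>h c. c\<^sub>h > 0 \<Longrightarrow> \<psi> c\<^sub>h 0 c = \<psi>0"
  shows "\<forall>n c p.
     (\<lambda>c\<^sub>h. div_c M (mid (E c\<^sub>h) n) c) \<in> O[at_top](\<lambda>c\<^sub>h. (c\<^sub>0 / c\<^sub>h)\<^sup>2) \<and>
     (\<lambda>c\<^sub>h. div_p M (mid (B c\<^sub>h) n) p) \<in> O[at_top](\<lambda>c\<^sub>h. (c\<^sub>0 / c\<^sub>h)\<^sup>2)"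
proof (intro allI conjI)
  fix n c p
  show "(\<lambda>c\<^sub>h. div_c M (mid (E c\<^sub>h) n) c) \<in> O[at_top](\<lambda>c\<^sub>h. (c\<^sub>0 / c\<^sub>h)\<^sup>2)"
  proof (rule cleaning_divergence_bigo)
    show "cleaning_system M (\<Delta>t * c\<^sub>h) (E c\<^sub>h) (\<psi> c\<^sub>h)" if "c\<^sub>h > 0" for c\<^sub>h
      using scheme_cleaning_E[OF mesh scheme[OF that]] .
  qed (use assms in \<open>auto simp: staggered_mesh_def\<close>)
  have "(\<lambda>c\<^sub>h. div_c (dual_mesh M) (mid (B c\<^sub>h) n) p) \<in> O[at_top](\<lambda>c\<^sub>h. (c\<^sub>0 / c\<^sub>h)\<^sup>2)"
  proof (rule cleaning_divergence_bigo)
    show "cleaning_system (dual_mesh M) (\<Delta>t * c\<^sub>h) (B c\<^sub>h) (\<phi> c\<^sub>h)" if "c\<^sub>h > 0" for c\<^sub>h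
      using scheme_cleaning_B[OF mesh scheme[OF that]] .
  qed (use assms in \<open>auto simp: staggered_mesh_def dual_mesh_simps\<close>)
  then show "(\<lambda>c\<^sub>h. div_p M (mid (B c\<^sub>h) n) p) \<in> O[at_top](\<lambda>c\<^sub>h. (c\<^sub>0 / c\<^sub>h)\<^sup>2)"
    by (simp add: div_c_dual_mesh)
qed

end
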